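(* There is a computable perfect tree $T$ such that every path through $T$ has asymptotic density $1/2$, and the symmetric difference of any two distinct paths through $T$ also has asymptotic density $1/2$.
   Context: A perfect tree is a map $T:2^{<\omega}\to 2^{<\omega}$ such that for each $\sigma$, the strings $T(\sigma^\frown0)$ and $T(\sigma^\frown1)$ are incompatible and both properly extend $T(\sigma)$; its paths are the sets $T(X)=\bigcup_{\sigma\prec X}T(\sigma)$ for $X\in2^\omega$. The asymptotic density of $A\subseteq\omega$ is $\lim_n |A\cap[0,n)|/n$ when this limit exists. *)

theory Defs
  imports Complex_Main "HOL-Library.Sublist"
begin

section \<open>Computable functions on natural numbers and on binary strings\<close>

text \<open>
  Partial recursive functions: terms built from zero, successor and projections by
  composition, primitive recursion and unbounded minimisation.  Terms carry no arity;
  a term applied to an argument list of unsuitable length may be undefined.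
\<close>

datatype recf =
    Zero
  | Succ
  | Proj nat
  | Comp recf "recf list"
  | PrimRec recf recf
  | Mu recf

text \<open>
  \<open>recf_eval p xs y\<close> means that \<open>p\<close> converges on the arguments \<open>xs\<close> with value \<open>y\<close>.
  In primitive recursion the step function receives the previous value, the recursion
  counter and the parameters, in this order.  Minimisation is over the first argument and
  requires convergence at all smaller arguments.
\<close>

inductive recf_eval :: "recf \<Rightarrow> nat list \<Rightarrow> nat \<Rightarrow> bool" where
  Zero: "recf_eval Zero xs 0"
| Succ: "recf_eval Succ [x] (Suc x)"
| Proj: "i < length xs \<Longrightarrow> recf_eval (Proj i) xs (xs ! i)"
| Comp: "list_all2 (\<lambda>g y. recf_eval g xs y) gs ys \<Longrightarrow> recf_eval f ys z \<Longrightarrow>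
           recf_eval (Comp f gs) xs z"
| PrimRec_0: "recf_eval g xs y \<Longrightarrow> recf_eval (PrimRec g h) (0 # xs) y"
| PrimRec_Suc: "recf_eval (PrimRec g h) (n # xs) y \<Longrightarrow> recf_eval h (y # n # xs) z \<Longrightarrow>
           recf_eval (PrimRec g h) (Suc n # xs) z"
| Mu: "recf_eval f (n # xs) 0 \<Longrightarrow> (\<forall>m<n. \<exists>k. recf_eval f (m # xs) (Suc k)) \<Longrightarrow>
           recf_eval (Mu f) xs n"

inductive_cases recf_eval_ZeroE: "recf_eval Zero xs y"
inductive_cases recf_eval_SuccE: "recf_eval Succ xs y"
inductive_cases recf_eval_ProjE: "recf_eval (Proj i) xs y"
inductive_cases recf_eval_CompE: "recf_eval (Comp f gs) xs y"
inductive_cases recf_eval_PrimRec_0E: "recf_eval (PrimRec g h) (0 # xs) y"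
inductive_cases recf_eval_PrimRec_SucE: "recf_eval (PrimRec g h) (Suc n # xs) y"
inductive_cases recf_eval_MuE: "recf_eval (Mu f) xs y"

lemma recf_eval_deterministic:
  "recf_eval p xs y \<Longrightarrow> recf_eval p xs y' \<Longrightarrow> y = y'"
proof (induction arbitrary: y' rule: recf_eval.induct)
  case (Zero xs)
  then show ?case by (elim recf_eval_ZeroE) simp
next
  case (Succ x)
  then show ?case by (elim recf_eval_SuccE) simp
next
  case (Proj i xs)
  from Proj.prems show ?case by (elim recf_eval_ProjE) simp
next
  case (Comp xs gs ys f z)
  from Comp.prems obtain ys' where
    ys': "list_all2 (\<lambda>g y. recf_eval g xs y) gs ys'" and z: "recf_eval f ys' y'"
    by (elim recf_eval_CompE)
  have "ys = ys'"
  proof (rule nth_equalityI)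
    show "length ys = length ys'"
      using list_all2_lengthD[OF Comp.IH(1)] list_all2_lengthD[OF ys'] by simp
  next
    fix i assume "i < length ys"
    then show "ys ! i = ys' ! i"
      using list_all2_nthD2[OF Comp.IH(1)] list_all2_nthD[OF ys'] list_all2_lengthD[OF Comp.IH(1)]
      by simp
  qed
  with Comp.IH(2) z show ?case by blast
next
  case (PrimRec_0 g xs y h)
  from PrimRec_0.prems have "recf_eval g xs y'" by (elim recf_eval_PrimRec_0E)
  with PrimRec_0.IH show ?case by blast
next
  case (PrimRec_Suc g h n xs y z)
  from PrimRec_Suc.prems obtain u where
    "recf_eval (PrimRec g h) (n # xs) u" "recf_eval h (u # n # xs) y'"
    by (elim recf_eval_PrimRec_SucE)
  with PrimRec_Suc.IH show ?case by blast
next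
  case (Mu f n xs)
  from Mu.prems have y': "recf_eval f (y' # xs) 0"
    and below: "\<forall>m<y'. \<exists>k. recf_eval f (m # xs) (Suc k)"
    by (elim recf_eval_MuE, blast)+
  show ?case
  proof (rule linorder_cases[of n y'])
    assume "n < y'"
    with below obtain k where "recf_eval f (n # xs) (Suc k)" by blast
    with Mu.IH(1) have "0 = Suc k" by blast
    then show ?thesis by simp
  next
    assume "y' < n"
    with Mu.IH(2) y' have "\<exists>k. Suc k = 0" by blast
    then show ?thesis by simp
  qed
qed

definition computable_nat_fun :: "(nat \<Rightarrow> nat) \<Rightarrow> bool" where
  "computable_nat_fun f \<longleftrightarrow> (\<exists>p. \<forall>n. recf_eval p [n] (f n))"

text \<open>
  Binary strings are coded by their position in the length-lexicographic order:
  \<open>string_code \<sigma> + 1\<close> is the number with binary expansion \<open>1\<sigma>\<close>.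
\<close>

definition string_code :: "bool list \<Rightarrow> nat" where
  "string_code \<sigma> = foldl (\<lambda>n b. 2 * n + 1 + of_bool b) 0 \<sigma>"

lemma string_code_snoc: "string_code (\<sigma> @ [b]) = 2 * string_code \<sigma> + 1 + of_bool b"
  by (simp add: string_code_def)

lemma bij_string_code: "bij string_code"
proof (rule bijI)
  show "inj string_code"
  proof (rule injI)
    fix \<sigma> \<tau> :: "bool list"
    assume "string_code \<sigma> = string_code \<tau>"
    then show "\<sigma> = \<tau>"
    proof (induction \<sigma> arbitrary: \<tau> rule: rev_induct)
      case Nil
      then show ?case by (cases \<tau> rule: rev_cases) (auto simp: string_code_def)
    next
      case (snoc b \<sigma>)
      show ?case
      proof (cases \<tau> rule: rev_cases)
        case Nil
        with snoc.prems show ?thesis by (simp add: string_code_def)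
      next
        case (snoc \<tau>' c)
        with snoc.prems have "2 * string_code \<sigma> + of_bool b = 2 * string_code \<tau>' + of_bool c"
          by (simp add: string_code_snoc)
        then have "string_code \<sigma> = string_code \<tau>' \<and> b = c"
          by (cases b; cases c; simp; presburger)
        with snoc.IH snoc show ?thesis by blast
      qed
    qed
  qed
  show "surj string_code"
  proof -
    have "\<exists>\<sigma>. n = string_code \<sigma>" for n
    proof (induction n rule: less_induct)
      case (less n)
      show ?case
      proof (cases n)
        case 0
        then show ?thesis by (intro exI[of _ "[]"]) (simp add: string_code_def)
      next
        case (Suc m)
        then have "m div 2 < n" by simp
        with less.IH obtain \<sigma> where "m div 2 = string_code \<sigma>" by blast
        with Suc have "n = string_code (\<sigma> @ [odd m])"
          by (cases "odd m") (auto simp: string_code_snoc elim!: oddE)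
        then show ?thesis by blast
      qed
    qed
    then show ?thesis by (auto simp: surj_def)
  qed
qed

definition computable_string_fun :: "(bool list \<Rightarrow> bool list) \<Rightarrow> bool" where
  "computable_string_fun T \<longleftrightarrow>
     (\<exists>f. computable_nat_fun f \<and> (\<forall>\<sigma>. f (string_code \<sigma>) = string_code (T \<sigma>)))"


section \<open>Perfect trees, paths and asymptotic density\<close>

definition perfect_tree :: "(bool list \<Rightarrow> bool list) \<Rightarrow> bool" where
  "perfect_tree T \<longleftrightarrow>
     (\<forall>\<sigma>. T (\<sigma> @ [False]) \<parallel> T (\<sigma> @ [True]) \<and>
          strict_prefix (T \<sigma>) (T (\<sigma> @ [False])) \<and>
          strict_prefix (T \<sigma>) (T (\<sigma> @ [True])))"

text \<open>Elements of \<open>2\<^sup>\<omega>\<close> are identified with sets of natural numbers.\<close>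

definition initial_segment :: "bool list \<Rightarrow> nat set \<Rightarrow> bool" where
  "initial_segment \<sigma> X \<longleftrightarrow> (\<forall>i<length \<sigma>. \<sigma> ! i \<longleftrightarrow> i \<in> X)"

text \<open>
  The union of the strings \<open>T \<sigma>\<close> for initial segments \<open>\<sigma>\<close> of \<open>X\<close>, as a set: for a perfect
  tree these strings are comparable and unboundedly long, so position \<open>n\<close> holds the same
  bit in all of them that are long enough.
\<close>

definition tree_path :: "(bool list \<Rightarrow> bool list) \<Rightarrow> nat set \<Rightarrow> nat set" where
  "tree_path T X = {n. \<exists>\<sigma>. initial_segment \<sigma> X \<and> n < length (T \<sigma>) \<and> T \<sigma> ! n}"

definition tree_paths :: "(bool list \<Rightarrow> bool list) \<Rightarrow> nat set set" where
  "tree_paths T = range (tree_path T)"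

definition has_density :: "nat set \<Rightarrow> real \<Rightarrow> bool" where
  "has_density A d \<longleftrightarrow> (\<lambda>n. real (card (A \<inter> {0..<n})) / real n) \<longlonglongrightarrow> d"

end

theory Submission
  imports Defs
begin

text \<open>
  Put \<open>T [] = 01\<close> and let \<open>T (\<sigma> b)\<close> be \<open>T \<sigma>\<close> followed by its copy (\<open>b = 0\<close>) or its bitwise
  complement (\<open>b = 1\<close>).  Position \<open>n\<close> of the path above \<open>X\<close> then holds the inner product
  modulo 2 of the binary digits of \<open>n\<close>, least significant first, with \<open>1X\<close>; so two positions
  that differ only in the digit of weight \<open>2\<^sup>j\<close> hold different bits iff position \<open>j\<close> of \<open>1X\<close>
  is 1.  Taking \<open>j = 0\<close>, each path contains exactly one number out of every pair
  \<open>2k, 2k+1\<close>.  If \<open>X\<close> and \<open>Y\<close> differ at \<open>i\<close>, then the symmetric difference of their paths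
  contains exactly one of \<open>n\<close> and \<open>n + 2\<^sup>i\<^sup>+\<^sup>1\<close> whenever the digit of \<open>n\<close> of weight
  \<open>2\<^sup>i\<^sup>+\<^sup>1\<close> is 0.
\<close>

section \<open>Recursive functions\<close>

text \<open>The arity is a condition on the length of the argument list, so that closure rules of
  all arities have one form and can be chained by \<open>intro\<close>.\<close>

definition rec_fun :: "nat \<Rightarrow> (nat list \<Rightarrow> nat) \<Rightarrow> bool" where
  "rec_fun n f \<longleftrightarrow> (\<exists>p. \<forall>xs. length xs = n \<longrightarrow> recf_eval p xs (f xs))"

abbreviation rec1 :: "(nat \<Rightarrow> nat) \<Rightarrow> bool" where
  "rec1 f \<equiv> rec_fun 1 (\<lambda>xs. f (xs ! 0))"

abbreviation rec2 :: "(nat \<Rightarrow> nat \<Rightarrow> nat) \<Rightarrow> bool" where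
  "rec2 f \<equiv> rec_fun 2 (\<lambda>xs. f (xs ! 0) (xs ! 1))"

lemma rec_fun_cong:
  assumes "rec_fun n f" "\<And>xs. length xs = n \<Longrightarrow> f xs = g xs"
  shows "rec_fun n g"
  using assms unfolding rec_fun_def by metis

lemma rec_fun_comp:
  assumes "rec_fun (length gs) f" and "\<forall>g\<in>set gs. rec_fun n g"
  shows "rec_fun n (\<lambda>xs. f (map (\<lambda>g. g xs) gs))"
proof -
  from assms(1) obtain p where
    p: "\<And>xs. length xs = length gs \<Longrightarrow> recf_eval p xs (f xs)"
    unfolding rec_fun_def by blast
  from assms(2) have "\<forall>g\<in>set gs. \<exists>q. \<forall>xs. length xs = n \<longrightarrow> recf_eval q xs (g xs)"
    unfolding rec_fun_def by blast
  then obtain q where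
    q: "\<And>g xs. g \<in> set gs \<Longrightarrow> length xs = n \<Longrightarrow> recf_eval (q g) xs (g xs)"
    by metis
  have "recf_eval (Comp p (map q gs)) xs (f (map (\<lambda>g. g xs) gs))" if "length xs = n" for xs
  proof (rule recf_eval.Comp)
    show "list_all2 (\<lambda>g y. recf_eval g xs y) (map q gs) (map (\<lambda>g. g xs) gs)"
      using q that by (simp add: list_all2_conv_all_nth)
    show "recf_eval p (map (\<lambda>g. g xs) gs) (f (map (\<lambda>g. g xs) gs))"
      by (rule p) simp
  qed
  then show ?thesis unfolding rec_fun_def by blast
qed

lemma rec_fun_comp1:
  assumes "rec1 f" "rec_fun n g"
  shows "rec_fun n (\<lambda>xs. f (g xs))"
  using rec_fun_comp[of "[g]" "\<lambda>xs. f (xs ! 0)" n] assms by simp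

lemma rec_fun_comp2:
  assumes "rec2 f" "rec_fun n g" "rec_fun n h"
  shows "rec_fun n (\<lambda>xs. f (g xs) (h xs))"
  using rec_fun_comp[of "[g, h]" "\<lambda>xs. f (xs ! 0) (xs ! 1)" n] assms
  by (simp add: numeral_2_eq_2)

lemma rec_fun_nth: "i < n \<Longrightarrow> rec_fun n (\<lambda>xs. xs ! i)"
  unfolding rec_fun_def using recf_eval.Proj by blast

lemma rec1_Suc: "rec1 Suc"
  unfolding rec_fun_def
proof (intro exI allI impI)
  fix xs :: "nat list"
  assume "length xs = 1"
  then show "recf_eval Succ xs (Suc (xs ! 0))"
    by (cases xs) (auto intro: recf_eval.Succ)
qed

lemma rec_fun_Suc: "rec_fun n f \<Longrightarrow> rec_fun n (\<lambda>xs. Suc (f xs))"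
  by (rule rec_fun_comp1[OF rec1_Suc])

lemma rec_fun_const: "rec_fun n (\<lambda>xs. c)"
proof (induction c)
  case 0
  then show ?case unfolding rec_fun_def using recf_eval.Zero by blast
next
  case (Suc c)
  then show ?case by (rule rec_fun_Suc)
qed

lemma rec_fun_primrec:
  assumes g: "rec_fun n g" and h: "rec_fun (Suc (Suc n)) h"
    and F0: "\<And>xs. length xs = n \<Longrightarrow> F (0 # xs) = g xs"
    and FSuc: "\<And>k xs. length xs = n \<Longrightarrow> F (Suc k # xs) = h (F (k # xs) # k # xs)"
  shows "rec_fun (Suc n) F"
proof -
  from g obtain p where p: "\<And>xs. length xs = n \<Longrightarrow> recf_eval p xs (g xs)"
    unfolding rec_fun_def by blast
  from h obtain q where q: "\<And>xs. length xs = Suc (Suc n) \<Longrightarrow> recf_eval q xs (h xs)"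
    unfolding rec_fun_def by blast
  have *: "recf_eval (PrimRec p q) (k # xs) (F (k # xs))" if "length xs = n" for k xs
  proof (induction k)
    case 0
    then show ?case using p[OF that] by (simp add: F0 that recf_eval.PrimRec_0)
  next
    case (Suc k)
    have "recf_eval q (F (k # xs) # k # xs) (h (F (k # xs) # k # xs))"
      by (rule q) (simp add: that)
    with Suc show ?case by (simp add: FSuc that recf_eval.PrimRec_Suc)
  qed
  have "recf_eval (PrimRec p q) xs (F xs)" if "length xs = Suc n" for xs
    using that * by (cases xs) auto
  then show ?thesis unfolding rec_fun_def by blast
qed

lemma rec1_primrec:
  assumes "rec2 h" and "\<And>k. f (Suc k) = h (f k) k"
  shows "rec1 f"
  using rec_fun_primrec[of 0 "\<lambda>xs. f 0" "\<lambda>xs. h (xs ! 0) (xs ! 1)" "\<lambda>xs. f (xs ! 0)"]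
    assms rec_fun_const by (simp add: numeral_2_eq_2)

lemma rec2_primrec:
  assumes "rec1 g" and "rec_fun 3 (\<lambda>xs. h (xs ! 0) (xs ! 1) (xs ! 2))"
    and "\<And>x. f 0 x = g x" and "\<And>k x. f (Suc k) x = h (f k x) k x"
  shows "rec2 f"
  using rec_fun_primrec[of 1 "\<lambda>xs. g (xs ! 0)" "\<lambda>xs. h (xs ! 0) (xs ! 1) (xs ! 2)"
      "\<lambda>xs. f (xs ! 0) (xs ! 1)"] assms
  by (simp add: numeral_2_eq_2 numeral_3_eq_3)

section \<open>Arithmetic and case distinction\<close>

lemma rec2_add: "rec2 (+)"
  by (rule rec2_primrec[where g = "\<lambda>x. x" and h = "\<lambda>y k x. Suc y"])
    (auto intro!: rec_fun_nth rec_fun_Suc)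

lemmas rec_fun_add = rec_fun_comp2[OF rec2_add]

lemma rec2_mult: "rec2 (*)"
  by (rule rec2_primrec[where g = "\<lambda>x. 0" and h = "\<lambda>y k x. x + y"])
    (auto intro!: rec_fun_nth rec_fun_const rec_fun_add)

lemmas rec_fun_mult = rec_fun_comp2[OF rec2_mult]

lemma rec1_pred: "rec1 (\<lambda>x. x - 1)"
  by (rule rec1_primrec[where h = "\<lambda>y k. k"]) (auto intro!: rec_fun_nth[of 1 2, simplified])

lemmas rec_fun_pred = rec_fun_comp1[OF rec1_pred]

lemma rec2_diff: "rec2 (-)"
proof -
  \<comment> \<open>Primitive recursion is on the first argument, here the subtrahend; the arguments
    are swapped afterwards.\<close>
  have "rec2 (\<lambda>k x. x - k)"
    by (rule rec2_primrec[where g = "\<lambda>x. x" and h = "\<lambda>y k x. y - 1"])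
      (auto intro!: rec_fun_nth rec_fun_pred simp del: One_nat_def)
  from rec_fun_comp2[OF this, of 2 "\<lambda>xs. xs ! 1" "\<lambda>xs. xs ! 0"]
  show ?thesis by (simp add: rec_fun_nth)
qed

lemmas rec_fun_diff = rec_fun_comp2[OF rec2_diff]

lemma rec1_half: "rec1 (\<lambda>x. x div 2)"
proof (rule rec1_primrec[where h = "\<lambda>y k. k - y"])
  show "rec2 (\<lambda>y k. k - y)" by (intro rec_fun_diff rec_fun_nth) simp_all
  show "Suc k div 2 = k - k div 2" for k by presburger
qed

lemmas rec_fun_half = rec_fun_comp1[OF rec1_half]

lemma rec1_mod2: "rec1 (\<lambda>x. x mod 2)"
  by (rule rec1_primrec[where h = "\<lambda>y k. 1 - y"])
    (auto intro!: rec_fun_nth rec_fun_diff rec_fun_const simp: mod_Suc)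

lemmas rec_fun_mod2 = rec_fun_comp1[OF rec1_mod2]

lemma rec_fun_if_zero:
  assumes "rec_fun n f" "rec_fun n g" "rec_fun n h"
  shows "rec_fun n (\<lambda>xs. if f xs = 0 then g xs else h xs)"
proof (rule rec_fun_cong)
  \<comment> \<open>Truncated subtraction makes \<open>1 - f xs\<close> the indicator of
    \<open>f xs = 0\<close>.\<close>
  show "rec_fun n (\<lambda>xs. (1 - f xs) * g xs + (1 - (1 - f xs)) * h xs)"
    by (intro rec_fun_add rec_fun_mult rec_fun_diff rec_fun_const assms)
qed auto

text \<open>
  Recursion along the length-lexicographic coding of strings, in which the code of \<open>\<sigma>\<close> is
  \<open>(q - 1) div 2\<close> when the code of \<open>\<sigma> b\<close> is \<open>q\<close>.  It is unfolded into a primitive recursion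
  through the ancestors of \<open>q\<close>, starting at the \<open>q\<close>-th one, which is the empty string.
\<close>

lemma rec1_string_recursion:
  assumes s: "rec2 s" and step: "\<And>q. q > 0 \<Longrightarrow> f q = s (f ((q - 1) div 2)) q"
  shows "rec1 f"
proof -
  \<comment> \<open>Since \<open>0 - 1 = 0\<close>, the root is its own parent and iterating past it
    is harmless.\<close>
  define anc where "anc j q = ((\<lambda>x. (x - 1) div 2) ^^ j) q" for j q :: nat
  have rec_anc: "rec2 anc"
    by (rule rec2_primrec[where g = "\<lambda>x. x" and h = "\<lambda>y k x. (y - 1) div 2"])
      (auto intro!: rec_fun_nth rec_fun_half rec_fun_pred simp: anc_def simp del: One_nat_def)
  note rec_fun_anc = rec_fun_comp2[OF rec_anc]
  \<comment> \<open>A step lowers every positive code by at least 1, so the \<open>q\<close>-th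
    ancestor of \<open>q\<close> is 0.\<close>
  have anc_le: "anc j q \<le> q - j" for j q
    by (induction j) (auto simp: anc_def)
  \<comment> \<open>\<open>F t q\<close> is to be the value of \<open>f\<close> at the
    \<open>(q - t)\<close>-th ancestor. While the next ancestor is still 0, the value
    \<open>f 0\<close> is carried along, as \<open>step\<close> covers positive codes only.\<close>
  define F where "F = (\<lambda>t q. rec_nat (f 0)
    (\<lambda>t y. if anc (q - Suc t) q = 0 then y else s y (anc (q - Suc t) q)) t)"
  have F: "rec2 F"
  proof (rule rec2_primrec[where g = "\<lambda>x. f 0" and
        h = "\<lambda>y t q. if anc (q - Suc t) q = 0 then y else s y (anc (q - Suc t) q)"])
    show "rec_fun 3 (\<lambda>xs. if anc (xs ! 2 - Suc (xs ! 1)) (xs ! 2) = 0 then xs ! 0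
        else s (xs ! 0) (anc (xs ! 2 - Suc (xs ! 1)) (xs ! 2)))"
      by (intro rec_fun_if_zero rec_fun_comp2[OF s] rec_fun_anc rec_fun_diff rec_fun_Suc
          rec_fun_nth) simp_all
  qed (simp_all add: F_def rec_fun_const)
  have F_eq: "F t q = f (anc (q - t) q)" if "t \<le> q" for t q
    using that
  proof (induction t)
    case 0
    then show ?case using anc_le[of q q] by (simp add: F_def)
  next
    case (Suc t)
    define a where "a = anc (q - Suc t) q"
    have "q - t = Suc (q - Suc t)" using Suc.prems by simp
    then have "anc (q - t) q = (a - 1) div 2" by (simp add: a_def anc_def)
    with Suc have IH: "F t q = f ((a - 1) div 2)" by simp
    have "F (Suc t) q = (if a = 0 then F t q else s (F t q) a)"
      by (simp add: F_def a_def)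
    also have "\<dots> = f a" using IH step[of a] by auto
    finally show ?case by (simp add: a_def)
  qed
  have "rec1 (\<lambda>q. F q q)"
    by (rule rec_fun_comp2[OF F]) (simp_all add: rec_fun_nth)
  then show ?thesis by (simp add: F_eq anc_def)
qed

lemma computable_nat_fun_rec1:
  assumes "rec1 f"
  shows "computable_nat_fun f"
proof -
  from assms obtain p where p: "\<And>xs. length xs = 1 \<Longrightarrow> recf_eval p xs (f (xs ! 0))"
    unfolding rec_fun_def by blast
  have "recf_eval p [n] (f n)" for n using p[of "[n]"] by simp
  then show ?thesis unfolding computable_nat_fun_def by blast
qed

section \<open>The tree\<close>

text \<open>These are the rows of Sylvester's Hadamard matrices, with \<open>True\<close> for the
  entry -1.\<close>

definition had :: "bool list \<Rightarrow> bool list" where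
  "had w = foldl (\<lambda>u b. u @ map (\<lambda>x. x \<noteq> b) u) [False] w"

lemma had_Nil: "had [] = [False]"
  by (simp add: had_def)

lemma had_snoc: "had (w @ [b]) = had w @ map (\<lambda>x. x \<noteq> b) (had w)"
  by (simp add: had_def)

lemma length_had: "length (had w) = 2 ^ length w"
  by (induction w rule: rev_induct) (simp_all add: had_Nil had_snoc)

lemma prefix_had: "prefix (had w) (had (w @ v))"
proof (induction v rule: rev_induct)
  case (snoc b v)
  then show ?case
    by (metis append.assoc had_snoc prefixI prefix_order.trans)
qed simp

text \<open>Induction drops the last letter, which belongs to the most significant digit. If that is
  digit \<open>j\<close>, the two positions correspond in the two halves of the string; otherwise
  both lie in the same half.\<close>

lemma had_flip:
  assumes "j < length w" and "n mod 2 ^ Suc j < 2 ^ j" and "n + 2 ^ j < 2 ^ length w"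
  shows "had w ! (n + 2 ^ j) \<longleftrightarrow> (had w ! n \<noteq> w ! j)"
  using assms
proof (induction w arbitrary: n rule: rev_induct)
  case Nil
  then show ?case by simp
next
  case (snoc b w)
  let ?k = "length w"
  let ?L = "2 ^ ?k :: nat"
  show ?case
  proof (cases "j = ?k")
    case True
    with snoc.prems have "n < ?L" by simp
    with True show ?thesis by (simp add: had_snoc nth_append length_had)
  next
    case False
    with snoc.prems have j: "j < ?k" by simp
    then have dvd: "2 ^ Suc j dvd ?L" by (intro le_imp_power_dvd) simp
    \<comment> \<open>Aligned blocks of length \<open>2 ^ Suc j\<close> do not straddle
      \<open>?L\<close>, and the shift stays within the block of \<open>n\<close>.\<close>
    have low: "n + 2 ^ j < ?L" if "n < ?L" "n mod 2 ^ Suc j < 2 ^ j" for n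
    proof -
      from dvd obtain d where d: "?L = 2 ^ Suc j * d" by (rule dvdE)
      have "n div 2 ^ Suc j < d" using that(1) d
        by (metis less_mult_imp_div_less mult.commute)
      then have "2 ^ Suc j * (n div 2 ^ Suc j + 1) \<le> ?L"
        unfolding d by (intro mult_le_mono) auto
      moreover have "n = 2 ^ Suc j * (n div 2 ^ Suc j) + n mod 2 ^ Suc j"
        by (simp only: mult_div_mod_eq)
      then have "n + 2 ^ j < 2 ^ Suc j * (n div 2 ^ Suc j) + 2 * 2 ^ j"
        using that(2) by linarith
      then have "n + 2 ^ j < 2 ^ Suc j * (n div 2 ^ Suc j + 1)" by simp
      ultimately show ?thesis by linarith
    qed
    show ?thesis
    proof (cases "n < ?L")
      case True
      then show ?thesis using low[OF True snoc.prems(2)] snoc.IH[OF j snoc.prems(2)] j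
        by (simp add: had_snoc nth_append length_had)
    next
      case False
      \<comment> \<open>In the second half, \<open>b\<close> complements both bits or neither, so it
        cancels.\<close>
      define m where "m = n - ?L"
      have n: "n = ?L + m" using False by (simp add: m_def)
      have m: "m < ?L" using snoc.prems(3) n by simp
      have mm: "m mod 2 ^ Suc j < 2 ^ j"
        using snoc.prems(2) dvd unfolding n
        by (metis add.commute mod_add_self2 dvd_def mod_mult_self2)
      show ?thesis using low[OF m mm] snoc.IH[OF j mm] j m
        by (cases b) (auto simp: n had_snoc nth_append length_had)
    qed
  qed
qed

text \<open>The leading \<open>True\<close> makes positions \<open>2 * k\<close> and
  \<open>2 * k + 1\<close> of every string differ; letter \<open>i\<close> of
  \<open>\<sigma>\<close> thus belongs to the digit of weight \<open>2 ^ Suc i\<close>.\<close>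

definition had_tree :: "bool list \<Rightarrow> bool list" where
  "had_tree \<sigma> = had (True # \<sigma>)"

lemma had_tree_Nil: "had_tree [] = [False, True]"
  using had_snoc[of "[]" True] by (simp add: had_tree_def had_Nil)

lemma had_tree_snoc: "had_tree (\<sigma> @ [b]) = had_tree \<sigma> @ map (\<lambda>x. x \<noteq> b) (had_tree \<sigma>)"
  using had_snoc[of "True # \<sigma>" b] by (simp add: had_tree_def)

lemma length_had_tree: "length (had_tree \<sigma>) = 2 ^ Suc (length \<sigma>)"
  by (simp add: had_tree_def length_had)

lemma perfect_had_tree: "perfect_tree had_tree"
  unfolding perfect_tree_def
proof (intro allI conjI)
  fix \<sigma>
  have ne: "had_tree \<sigma> \<noteq> []" using length_had_tree[of \<sigma>] by auto
  then show "strict_prefix (had_tree \<sigma>) (had_tree (\<sigma> @ [False]))"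
    "strict_prefix (had_tree \<sigma>) (had_tree (\<sigma> @ [True]))"
    by (simp_all add: had_tree_snoc strict_prefix_def)
  have "map (\<lambda>x. x \<noteq> False) (had_tree \<sigma>) \<noteq> map (\<lambda>x. x \<noteq> True) (had_tree \<sigma>)"
    using ne by (cases "had_tree \<sigma>") auto
  then show "had_tree (\<sigma> @ [False]) \<parallel> had_tree (\<sigma> @ [True])"
    unfolding had_tree_snoc
    by (intro not_equal_is_parallel) simp_all
qed

section \<open>Computability of the tree\<close>

lemma string_code_Nil: "string_code [] = 0"
  by (simp add: string_code_def)

text \<open>\<open>string_code\<close> reads a string as a base 2 numeral with digits 1
  (\<open>False\<close>) and 2 (\<open>True\<close>), so appending \<open>v\<close> shifts
  \<open>u\<close> by \<open>length v\<close> places.\<close>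

lemma string_code_append:
  "string_code (u @ v) = 2 ^ length v * string_code u + string_code v"
proof (induction v rule: rev_induct)
  case (snoc b v)
  then show ?case
    using string_code_snoc[of "u @ v" b] by (simp add: string_code_snoc algebra_simps)
qed (simp add: string_code_Nil)

text \<open>In the same numeral system, complementary digits add up to 3 at every place.\<close>

lemma string_code_complement:
  "string_code (map Not u) = 3 * (2 ^ length u - 1) - string_code u"
proof -
  have "string_code (map Not u) + string_code u + 3 = 3 * 2 ^ length u"
    by (induction u rule: rev_induct) (auto simp: string_code_snoc string_code_Nil)
  then show ?thesis by (simp add: algebra_simps)
qed

lemma computable_had_tree: "computable_string_fun had_tree"
proof -
  define dec where "dec = inv string_code"
  have dec_code: "dec (string_code \<sigma>) = \<sigma>" for \<sigma>
    unfolding dec_def using bij_string_code by (simp add: bij_is_inj)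
  \<comment> \<open>Codes of appended and complemented strings involve the power
    \<open>2 ^ length\<close>, so this is computed first; \<open>E\<close> squares when the string
    doubles.\<close>
  define E where "E q = (2::nat) ^ length (had_tree (dec q))" for q
  define f where "f q = string_code (had_tree (dec q))" for q
  \<comment> \<open>The codes of strings ending in \<open>True\<close> are the positive even
    numbers.\<close>
  have cases_q: "\<exists>\<sigma> b. q = string_code (\<sigma> @ [b]) \<and> (q - 1) div 2 = string_code \<sigma> \<and>
      (q mod 2 = 0 \<longleftrightarrow> b)" if "q > 0" for q
  proof -
    obtain \<tau> where q: "q = string_code \<tau>"
      using bij_string_code by (metis bij_is_surj surjD)
    with that obtain \<sigma> b where "\<tau> = \<sigma> @ [b]"
      by (cases \<tau> rule: rev_cases) (auto simp: string_code_Nil)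
    with q show ?thesis
      by (intro exI[of _ \<sigma>] exI[of _ b]) (cases b; simp add: string_code_snoc; presburger)
  qed
  have E: "rec1 E"
  proof (rule rec1_string_recursion[where s = "\<lambda>y q. y * y"])
    show "rec2 (\<lambda>y q. y * y)" by (intro rec_fun_mult rec_fun_nth) simp_all
    fix q :: nat
    assume "q > 0"
    from cases_q[OF this] obtain \<sigma> b
      where "q = string_code (\<sigma> @ [b])" "(q - 1) div 2 = string_code \<sigma>" by blast
    then show "E q = E ((q - 1) div 2) * E ((q - 1) div 2)"
      by (simp add: E_def dec_code had_tree_snoc power_add)
  qed
  \<comment> \<open>With \<open>y\<close> the code of the parent's image, the first summand shifts
    that image by its own length; the second is the code of the appended copy or complement.\<close>
  define s where "s y q = E ((q - 1) div 2) * y +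
    (if q mod 2 = 0 then 3 * (E ((q - 1) div 2) - 1) - y else y)" for y q
  have "rec1 f"
  proof (rule rec1_string_recursion[where s = s])
    show "rec2 s"
      unfolding s_def
      by (intro rec_fun_add rec_fun_mult rec_fun_if_zero rec_fun_diff rec_fun_mod2
          rec_fun_comp1[OF E] rec_fun_half rec_fun_pred rec_fun_const rec_fun_nth) simp_all
    fix q :: nat
    assume "q > 0"
    from cases_q[OF this] obtain \<sigma> b where q: "q = string_code (\<sigma> @ [b])"
      and p: "(q - 1) div 2 = string_code \<sigma>" and b: "q mod 2 = 0 \<longleftrightarrow> b"
      by (elim exE conjE) (rule that)
    have "f q = string_code (had_tree \<sigma> @ map (\<lambda>x. x \<noteq> b) (had_tree \<sigma>))"
      by (simp add: f_def q dec_code had_tree_snoc)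
    also have "\<dots> = s (f ((q - 1) div 2)) q"
      unfolding s_def p b f_def E_def dec_code
      using string_code_complement[of "had_tree \<sigma>"]
      by (cases b) (simp_all add: string_code_append)
    finally show "f q = s (f ((q - 1) div 2)) q" .
  qed
  then have "computable_nat_fun f" by (rule computable_nat_fun_rec1)
  moreover have "\<forall>\<sigma>. f (string_code \<sigma>) = string_code (had_tree \<sigma>)"
    by (simp add: f_def dec_code)
  ultimately show ?thesis unfolding computable_string_fun_def by blast
qed

section \<open>Density of paths\<close>

text \<open>The shift by \<open>P\<close> exchanges members and non-members between the halves of
  each aligned block of length \<open>2 * P\<close>. So each block has exactly \<open>P\<close>
  members, and the count below \<open>n\<close> is within \<open>P\<close> of
  \<open>n / 2\<close>.\<close>

lemma has_density_half_if_paired: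
  fixes P :: nat
  assumes "P > 0" and flip: "\<And>n. n mod (2 * P) < P \<Longrightarrow> n + P \<in> S \<longleftrightarrow> n \<notin> S"
  shows "has_density S (1 / 2)"
proof -
  define c where "c n = card (S \<inter> {0..<n})" for n
  have block: "card (S \<inter> {2 * P * q..<2 * P * q + 2 * P}) = P" for q
  proof -
    let ?a = "2 * P * q"
    have pair: "n + P \<in> S \<longleftrightarrow> n \<notin> S" if n: "n \<in> {?a..<?a + P}" for n
    proof (rule flip)
      obtain r where "n = ?a + r" "r < P"
        using n by (intro that[of "n - ?a"]) auto
      then show "n mod (2 * P) < P" by simp
    qed
    have "S \<inter> {?a + P..<?a + 2 * P} = (\<lambda>n. n + P) ` ({?a..<?a + P} - S)"
    proof (intro equalityI subsetI)
      fix x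
      assume x: "x \<in> S \<inter> {?a + P..<?a + 2 * P}"
      then have "x - P \<in> {?a..<?a + P}" "x = (x - P) + P" by auto
      with x pair[of "x - P"] show "x \<in> (\<lambda>n. n + P) ` ({?a..<?a + P} - S)"
        by (intro image_eqI[of _ _ "x - P"]) auto
    qed (use pair in auto)
    then have "card (S \<inter> {?a + P..<?a + 2 * P}) = card ({?a..<?a + P} - S)"
      by (simp add: card_image)
    moreover have "S \<inter> {?a..<?a + 2 * P} = (S \<inter> {?a..<?a + P}) \<union> (S \<inter> {?a + P..<?a + 2 * P})"
      by auto
    then have "card (S \<inter> {?a..<?a + 2 * P}) =
        card (S \<inter> {?a..<?a + P}) + card (S \<inter> {?a + P..<?a + 2 * P})"
      by (simp add: card_Un_disjoint disjoint_iff)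
    moreover have "card (S \<inter> {?a..<?a + P}) + card ({?a..<?a + P} - S) = card {?a..<?a + P}"
      using card_Int_Diff[of "{?a..<?a + P}" S] by (simp add: Int_commute)
    ultimately show ?thesis by simp
  qed
  have full: "c (2 * P * q) = P * q" for q
  proof (induction q)
    case (Suc q)
    have "S \<inter> {0..<2 * P * Suc q} =
        (S \<inter> {0..<2 * P * q}) \<union> (S \<inter> {2 * P * q..<2 * P * q + 2 * P})"
      by auto
    then have "c (2 * P * Suc q) =
        c (2 * P * q) + card (S \<inter> {2 * P * q..<2 * P * q + 2 * P})"
      unfolding c_def by (simp add: card_Un_disjoint disjoint_iff)
    with Suc block show ?case by simp
  qed (simp add: c_def)
  have mono: "c m \<le> c n" if "m \<le> n" for m n
    unfolding c_def using that by (intro card_mono) auto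
  have bound: "\<bar>real (c n) - real n / 2\<bar> \<le> real P" for n
  proof -
    define q where "q = n div (2 * P)"
    have lo: "2 * P * q \<le> n" by (simp add: q_def)
    have hi: "n \<le> 2 * P * Suc q"
      using dividend_less_times_div[of "2 * P" n] \<open>P > 0\<close> unfolding q_def by simp
    \<comment> \<open>The count is squeezed between its known values at the ends of the block around
      \<open>n\<close>.\<close>
    have "P * q \<le> c n" "c n \<le> P * Suc q"
      using mono[OF lo] mono[OF hi] full by metis+
    then have "real P * real q \<le> real (c n)" "real (c n) \<le> real P * real q + real P"
      by (simp_all flip: of_nat_mult of_nat_add add: add.commute)
    moreover have "2 * (real P * real q) \<le> real n" "real n \<le> 2 * (real P * real q) + 2 * real P"
      using lo hi by (simp_all flip: of_nat_mult of_nat_add add: algebra_simps)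
    ultimately show ?thesis by linarith
  qed
  have "(\<lambda>n. real (c n) / real n - 1 / 2) \<longlonglongrightarrow> 0"
  proof (rule tendsto_0_le[where K = 1])
    show "(\<lambda>n. real P / real n) \<longlonglongrightarrow> 0" by (rule lim_const_over_n)
    show "\<forall>\<^sub>F n in sequentially. norm (real (c n) / real n - 1 / 2) \<le> norm (real P / real n) * 1"
      using eventually_gt_at_top[of 0]
    proof eventually_elim
      case (elim n)
      then have "real (c n) / real n - 1 / 2 = (real (c n) - real n / 2) / real n"
        by (simp add: field_simps)
      with bound[of n] elim show ?case by (simp add: divide_right_mono)
    qed
  qed
  then show ?thesis unfolding has_density_def c_def by (simp add: LIM_zero_iff)
qed

text \<open>The images of the initial segments of \<open>X\<close> form a chain of prefixes, so the
  segment of length \<open>k\<close> decides every position inside its image.\<close>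

lemma mem_tree_path_had_tree:
  assumes "n < 2 ^ Suc k"
  shows "n \<in> tree_path had_tree X \<longleftrightarrow> had_tree (map (\<lambda>i. i \<in> X) [0..<k]) ! n"
    (is "_ \<longleftrightarrow> had_tree (?p k) ! n")
proof -
  have initial: "\<sigma> = ?p (length \<sigma>)" if "initial_segment \<sigma> X" for \<sigma>
    using that by (intro nth_equalityI) (auto simp: initial_segment_def)
  \<comment> \<open>\<open>k\<close> is quantified anew, so that the fact also applies with the two
    lengths exchanged.\<close>
  have coherent_le: "had_tree (?p l) ! n = had_tree (?p k) ! n" if "n < 2 ^ Suc l" "l \<le> k" for l k
  proof -
    have "[0..<k] = [0..<l] @ [l..<k]" using \<open>l \<le> k\<close> upt_add_eq_append[of 0 l "k - l"] by simp
    then have "prefix (had_tree (?p l)) (had_tree (?p k))"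
      unfolding had_tree_def using prefix_had[of "True # ?p l" "map (\<lambda>i. i \<in> X) [l..<k]"] by simp
    then obtain v where "had_tree (?p k) = had_tree (?p l) @ v" by (auto simp: prefix_def)
    then show ?thesis using that(1) by (simp add: nth_append length_had_tree)
  qed
  have coherent: "had_tree (?p l) ! n = had_tree (?p k) ! n" if "n < 2 ^ Suc l" for l
    using linear[of l k]
  proof
    assume "l \<le> k"
    with that show ?thesis by (rule coherent_le)
  next
    assume "k \<le> l"
    with assms show ?thesis by (rule coherent_le[symmetric])
  qed
  show ?thesis
  proof
    assume "n \<in> tree_path had_tree X"
    then obtain \<sigma> where "initial_segment \<sigma> X" "n < 2 ^ Suc (length \<sigma>)" "had_tree \<sigma> ! n"
      unfolding tree_path_def length_had_tree by blast
    with initial coherent show "had_tree (?p k) ! n" by metis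
  next
    assume "had_tree (?p k) ! n"
    moreover have "initial_segment (?p k) X" by (simp add: initial_segment_def)
    moreover have "n < length (had_tree (?p k))" using assms by (simp add: length_had_tree)
    ultimately show "n \<in> tree_path had_tree X"
      unfolding tree_path_def by blast
  qed
qed

lemma tree_path_had_tree_flip:
  assumes "n mod 2 ^ Suc j < 2 ^ j"
  shows "n + 2 ^ j \<in> tree_path had_tree X \<longleftrightarrow>
    ((n \<in> tree_path had_tree X) \<noteq> (j = 0 \<or> j - 1 \<in> X))"
proof -
  \<comment> \<open>This length puts \<open>n + 2 ^ j\<close> inside the string and lets
    \<open>j\<close> index a letter.\<close>
  define k where "k = n + 2 ^ j + j"
  define w where "w = map (\<lambda>i. i \<in> X) [0..<k]"
  have "k < 2 ^ Suc k" by (metis Suc_lessD less_exp)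
  then have lt: "n + 2 ^ j < 2 ^ Suc k" "n < 2 ^ Suc k"
    unfolding k_def by linarith+
  have jk: "j < Suc k" by (simp add: k_def)
  then have nth: "(True # w) ! j \<longleftrightarrow> j = 0 \<or> j - 1 \<in> X"
    by (cases j) (simp_all add: w_def)
  have "had (True # w) ! (n + 2 ^ j) \<longleftrightarrow> (had (True # w) ! n \<noteq> (True # w) ! j)"
    by (rule had_flip) (use jk lt assms in \<open>simp_all add: w_def\<close>)
  then show ?thesis
    unfolding mem_tree_path_had_tree[OF lt(1)] mem_tree_path_had_tree[OF lt(2)]
      had_tree_def w_def by (simp only: nth[unfolded w_def])
qed

lemma density_path_had_tree: "has_density (tree_path had_tree X) (1 / 2)"
proof (rule has_density_half_if_paired[where P = "2 ^ 0"])
  fix n :: nat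
  assume "n mod (2 * 2 ^ 0) < 2 ^ 0"
  with tree_path_had_tree_flip[of n 0 X]
  show "n + 2 ^ 0 \<in> tree_path had_tree X \<longleftrightarrow> n \<notin> tree_path had_tree X" by simp
qed simp

lemma density_sym_diff_had_tree:
  assumes "X \<noteq> Y"
  shows "has_density (sym_diff (tree_path had_tree X) (tree_path had_tree Y)) (1 / 2)"
proof -
  obtain i where i: "i \<in> X \<longleftrightarrow> i \<notin> Y" using assms by blast
  show ?thesis
  \<comment> \<open>Raising the digit governed by bit \<open>i\<close> from 0 to 1 changes
    membership in exactly one of the two paths, hence in their symmetric difference.\<close>
  proof (rule has_density_half_if_paired[where P = "2 ^ Suc i"])
    fix n :: nat
    assume "n mod (2 * 2 ^ Suc i) < 2 ^ Suc i"
    then have "n mod 2 ^ Suc (Suc i) < 2 ^ Suc i" by simp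
    from tree_path_had_tree_flip[OF this, of X] tree_path_had_tree_flip[OF this, of Y] i
    show "n + 2 ^ Suc i \<in> sym_diff (tree_path had_tree X) (tree_path had_tree Y) \<longleftrightarrow>
        n \<notin> sym_diff (tree_path had_tree X) (tree_path had_tree Y)"
      by auto
  qed simp
qed

theorem theorem7p13:
  shows "\<exists>T :: bool list \<Rightarrow> bool list.
    perfect_tree T \<and> computable_string_fun T \<and>
    (\<forall>A \<in> tree_paths T. has_density A (1 / 2)) \<and>
    (\<forall>A \<in> tree_paths T. \<forall>B \<in> tree_paths T. A \<noteq> B \<longrightarrow> has_density (sym_diff A B) (1 / 2))"
proof (intro exI[of _ had_tree] conjI ballI impI)
  show "perfect_tree had_tree" by (rule perfect_had_tree)
  show "computable_string_fun had_tree" by (rule computable_had_tree)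
next
  fix A
  assume "A \<in> tree_paths had_tree"
  then show "has_density A (1 / 2)" by (auto simp: tree_paths_def density_path_had_tree)
next
  fix A B
  assume "A \<in> tree_paths had_tree" "B \<in> tree_paths had_tree" "A \<noteq> B"
  then obtain X Y where "A = tree_path had_tree X" "B = tree_path had_tree Y" "X \<noteq> Y"
    by (auto simp: tree_paths_def)
  then show "has_density (sym_diff A B) (1 / 2)" by (simp add: density_sym_diff_had_tree)
qed

end
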